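(* Let $k\ge 1$, let $A$ be a real $m\times n$ matrix with $m\ge n>\max(k,2)$ and singular values $\sigma_1\ge\sigma_2\ge\cdots\ge\sigma_n\ge 0$, and let $B$ be a real $m\times n$ matrix of rank at most $k$ such that $$\|A-B\|_F\le\sqrt{\eta^2+\sum_{j=k+1}^n\sigma_j^2}$$ for some $\eta\ge 0$. Then $$\|A-B\|_2\le\sqrt{\eta^2+\sigma_{k+1}^2}$$ and $$\sqrt{\sum_{j=1}^k\bigl(\sigma_j-\sigma_j(B)\bigr)^2}\le\eta .$$
   Context: $\|\cdot\|_2$ is the spectral norm and $\|\cdot\|_F$ the Frobenius norm. $\sigma_j(X)$ denotes the $j$-th largest singular value of $X$, and $\sigma_j=\sigma_j(A)$. *)

theory Defs
  imports
    "HOL-Analysis.Analysis"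
    "HOL-Computational_Algebra.Computational_Algebra"
begin

text \<open>
  A real \<open>m \<times> n\<close> matrix has type \<open>real ^ 'n ^ 'm\<close> with \<open>m = CARD('m)\<close> and \<open>n = CARD('n)\<close>.
\<close>

definition charpoly :: "real ^ 'n ^ 'n \<Rightarrow> real poly" where
  "charpoly M = det (mat [:0, 1:] - map_matrix (\<lambda>c. [:c:]) M)"

text \<open>
  The singular values of \<open>X\<close> are the square roots of the eigenvalues of \<open>X\<^sup>T X\<close>, repeated
  according to algebraic multiplicity and listed in decreasing order. The characteristic polynomial
  of the symmetric positive semidefinite matrix \<open>X\<^sup>T X\<close> splits over the reals with nonnegative
  roots, so the list has length \<open>CARD('n)\<close>; no root is lost by using real roots only.
\<close>

definition singular_values :: "real ^ 'n ^ 'm \<Rightarrow> real list" where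
  "singular_values X =
     rev (sorted_list_of_multiset (image_mset sqrt (proots (charpoly (transpose X ** X)))))"

text \<open>
  Indexing is one-based: \<open>singular_value j X\<close> is the \<open>j\<close>-th largest singular value, meaningful for
  \<open>1 \<le> j \<le> CARD('n)\<close>.
\<close>

definition singular_value :: "nat \<Rightarrow> real ^ 'n ^ 'm \<Rightarrow> real" where
  "singular_value j X = singular_values X ! (j - 1)"

definition spectral_norm :: "real ^ 'n ^ 'm \<Rightarrow> real" where
  "spectral_norm X = onorm (\<lambda>v. X *v v)"

definition frobenius_norm :: "real ^ 'n ^ 'm \<Rightarrow> real" where
  "frobenius_norm X = sqrt (\<Sum>i\<in>UNIV. \<Sum>j\<in>UNIV. (X $ i $ j)\<^sup>2)"

lemma frobenius_norm_eq_norm: "frobenius_norm X = norm X"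
  by (simp add: frobenius_norm_def norm_vec_def L2_set_def sum_nonneg)

end

theory Submission
  imports Defs
begin

text \<open>
  Write \<open>\<gamma>\<^sub>1 \<ge> \<gamma>\<^sub>2 \<ge> \<dots>\<close> for the singular values of \<open>A - B\<close>. The squared Frobenius norm is the sum of the
  squares of the singular values (\<open>frobenius_norm_singular_values\<close>), so the hypothesis bounds
  \<open>\<Sum>\<gamma>\<^sub>j\<^sup>2\<close> by \<open>\<eta>\<^sup>2\<close> plus the sum of \<open>\<sigma>\<^sub>j\<^sup>2\<close> over \<open>j > k\<close>. Each conclusion cancels a different part of this
  tail.

  For the spectral norm, Weyl's inequality for a perturbation of rank at most \<open>k\<close> gives
  \<open>\<sigma>\<^bsub>j+k\<^esub> \<le> \<gamma>\<^sub>j\<close> (\<open>singular_value_rank_perturbation\<close>). Using it for \<open>j \<ge> 2\<close> cancels all of the tail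
  except \<open>\<sigma>\<^bsub>k+1\<^esub>\<^sup>2\<close> and leaves \<open>\<gamma>\<^sub>1\<^sup>2 \<le> \<eta>\<^sup>2 + \<sigma>\<^bsub>k+1\<^esub>\<^sup>2\<close>; and \<open>\<gamma>\<^sub>1\<close> bounds the spectral norm.

  For the singular values, Mirsky's inequality (\<open>mirsky_inequality\<close>) bounds the sum of
  \<open>(\<sigma>\<^sub>j - \<sigma>\<^sub>j(B))\<^sup>2\<close> over all \<open>j\<close> by the squared Frobenius norm of \<open>A - B\<close>. Since \<open>\<sigma>\<^sub>j(B) = 0\<close> for
  \<open>j > k\<close>, the terms beyond \<open>k\<close> are exactly the tail, and the first \<open>k\<close> terms are left below \<open>\<eta>\<^sup>2\<close>.
  Expanding the squares turns Mirsky's inequality into von Neumann's trace inequality.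

  All of this rests on an orthonormal basis of right singular vectors
  (\<open>right_singular_basis_exists\<close>), which the spectral theorem provides.

  The lemmas number singular values from zero, as entries of the list \<open>singular_values X\<close>; the
  one-based numbering occurs only in the theorem and in this overview.
\<close>

section \<open>The spectral theorem for self-adjoint maps\<close>

text \<open>
  This is the calculus-free form of "the derivative vanishes at a maximum": for small \<open>t\<close> the
  linear term dominates, so a nonzero \<open>a\<close> would give a positive value for one sign of \<open>t\<close>.
\<close>

lemma linear_coeff_zero_of_quadratic_nonpos:
  fixes a b :: real
  assumes "\<And>t. 2 * t * a + t\<^sup>2 * b \<le> 0"
  shows "a = 0"
proof (rule ccontr)
  assume "a \<noteq> 0"
  \<comment> \<open>The witness \<open>t = a / c\<close> is small enough that the linear term beats \<open>b\<close>, whatever its sign.\<close>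
  define c where "c = \<bar>b\<bar> + 1"
  have c: "c > 0" "\<bar>b\<bar> < c" by (auto simp: c_def)
  have "2 * (a / c) * a + (a / c)\<^sup>2 * b = (a\<^sup>2 / c\<^sup>2) * (2 * c + b)"
    using c by (simp add: field_simps power2_eq_square)
  moreover have "\<dots> > 0"
    using c \<open>a \<noteq> 0\<close> by (intro mult_pos_pos) (auto simp: c_def)
  ultimately show False using assms[of "a / c"] by linarith
qed

text \<open>
  The Rayleigh quotient \<open>f x \<bullet> x\<close> attains its maximum on the compact unit sphere of \<open>S\<close>, and a
  maximiser is an eigenvector.
\<close>

lemma self_adjoint_eigenvector:
  fixes f :: "'a::euclidean_space \<Rightarrow> 'a"
  assumes lin: "linear f" and adj: "\<And>x y. f x \<bullet> y = x \<bullet> f y"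
    and S: "subspace S" and inv: "f ` S \<subseteq> S" and nt: "S \<noteq> {0}"
  obtains x c where "x \<in> S" "norm x = 1" "f x = c *\<^sub>R x"
proof -
  let ?K = "sphere 0 1 \<inter> S"
  obtain z where z: "z \<in> S" "z \<noteq> 0" using nt subspace_0[OF S] by auto
  have "(1 / norm z) *\<^sub>R z \<in> ?K" using z S by (simp add: subspace_scale)
  then have "?K \<noteq> {}" by blast
  moreover have "compact ?K" using closed_subspace[OF S] by (simp add: compact_Int_closed)
  moreover have "continuous_on ?K (\<lambda>x. f x \<bullet> x)"
    using lin by (intro continuous_intros linear_continuous_on linear_conv_bounded_linear[THEN iffD1])
  ultimately have "\<exists>x\<in>?K. \<forall>y\<in>?K. f y \<bullet> y \<le> f x \<bullet> x"
    by (intro continuous_attains_sup)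
  then obtain x where x: "x \<in> ?K" and xmax: "\<And>y. y \<in> ?K \<Longrightarrow> f y \<bullet> y \<le> f x \<bullet> x"
    by blast
  define c where "c = f x \<bullet> x"
  have xS: "x \<in> S" and nx: "norm x = 1" and xx: "x \<bullet> x = 1" using x by (auto simp: norm_eq_1)
  have le: "f y \<bullet> y \<le> c * (y \<bullet> y)" if "y \<in> S" for y
  proof (cases "y = 0")
    case False
    let ?u = "(1 / norm y) *\<^sub>R y"
    have "?u \<in> ?K" using False that S by (simp add: subspace_scale)
    from xmax[OF this] have "(f y \<bullet> y) / (norm y)\<^sup>2 \<le> c"
      by (simp add: linear_cmul[OF lin] c_def power2_eq_square)
    then show ?thesis using False by (simp add: pos_divide_le_eq power2_norm_eq_inner)
  qed (simp add: linear_0[OF lin])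
  define y where "y = f x - c *\<^sub>R x"
  have yS: "y \<in> S" using xS inv S by (auto simp: y_def intro!: subspace_diff subspace_scale)
  \<comment> \<open>First variation of the Rayleigh quotient at its maximiser, in the direction \<open>y\<close>: the
    linear coefficient is \<open>y \<bullet> y\<close>, so stationarity forces the residual \<open>y\<close> to vanish.\<close>
  have "2 * t * (y \<bullet> y) + t\<^sup>2 * (f y \<bullet> y - c * (y \<bullet> y)) \<le> 0" for t
  proof -
    have max: "f (x + t *\<^sub>R y) \<bullet> (x + t *\<^sub>R y) \<le> c * ((x + t *\<^sub>R y) \<bullet> (x + t *\<^sub>R y))"
      using xS yS S by (intro le subspace_add subspace_scale)
    have "f y \<bullet> x = f x \<bullet> y" using adj[of y x] by (simp add: inner_commute)
    then have e1: "f (x + t *\<^sub>R y) \<bullet> (x + t *\<^sub>R y) = c + 2 * t * (f x \<bullet> y) + t\<^sup>2 * (f y \<bullet> y)"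
      by (simp add: linear_add[OF lin] linear_cmul[OF lin] inner_add_left inner_add_right c_def
          power2_eq_square algebra_simps)
    have e2: "(x + t *\<^sub>R y) \<bullet> (x + t *\<^sub>R y) = 1 + 2 * t * (x \<bullet> y) + t\<^sup>2 * (y \<bullet> y)"
      by (simp add: inner_add_left inner_add_right xx inner_commute[of y x] power2_eq_square algebra_simps)
    have e3: "f x \<bullet> y = y \<bullet> y + c * (x \<bullet> y)"
      unfolding y_def by (simp add: inner_diff_left)
    show ?thesis using max unfolding e1 e2 e3 by (simp add: algebra_simps)
  qed
  then have "y \<bullet> y = 0" by (rule linear_coeff_zero_of_quadratic_nonpos)
  then have "f x = c *\<^sub>R x" by (simp add: y_def)
  with that xS nx show ?thesis by blast
qed

text \<open>
  Splitting off one eigenvector leaves its orthogonal complement, which is again invariant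
  because the map is self-adjoint, so induction on the dimension applies.
\<close>

lemma self_adjoint_orthonormal_eigenbasis:
  fixes f :: "'a::euclidean_space \<Rightarrow> 'a"
  assumes lin: "linear f" and adj: "\<And>x y. f x \<bullet> y = x \<bullet> f y"
    and "subspace S" and "f ` S \<subseteq> S"
  shows "\<exists>B. pairwise orthogonal B \<and> (\<forall>x\<in>B. norm x = 1) \<and>
    (\<forall>x\<in>B. \<exists>c. f x = c *\<^sub>R x) \<and> span B = S"
  using assms(3,4)
proof (induction "dim S" arbitrary: S rule: less_induct)
  case less
  show ?case
  proof (cases "S = {0}")
    case True
    then show ?thesis by (intro exI[of _ "{}"]) auto
  next
    case False
    obtain x c where x: "x \<in> S" "norm x = 1" "f x = c *\<^sub>R x"
      using self_adjoint_eigenvector[OF lin adj less.prems False] by blast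
    define T where "T = S \<inter> {y. x \<bullet> y = 0}"
    have T: "subspace T" unfolding T_def
      using subspace_inter[OF less.prems(1) subspace_hyperplane] .
    have fT: "f ` T \<subseteq> T"
    proof
      fix w assume "w \<in> f ` T"
      then obtain y where y: "y \<in> S" "x \<bullet> y = 0" "w = f y" by (auto simp: T_def)
      have "x \<bullet> f y = 0" using adj[of x y] x(3) y(2) by simp
      then show "w \<in> T" using y less.prems(2) by (auto simp: T_def)
    qed
    have "x \<bullet> x = 1" using x(2) by (simp add: norm_eq_1)
    then have "x \<notin> T" by (auto simp: T_def)
    moreover have "T \<subseteq> S" by (simp add: T_def)
    ultimately have "T \<subset> S" using x(1) by blast
    then have "dim T < dim S" using T less.prems(1) by (simp add: dim_psubset span_eq_iff[THEN iffD2])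
    from less.hyps[OF this T fT] obtain B where B: "pairwise orthogonal B" "\<forall>x\<in>B. norm x = 1"
      "\<forall>x\<in>B. \<exists>c. f x = c *\<^sub>R x" "span B = T" by blast
    have BT: "B \<subseteq> T" using B(4) span_superset by blast
    have "pairwise orthogonal (insert x B)"
      using B(1) BT by (auto simp: pairwise_insert T_def orthogonal_def inner_commute)
    moreover have "span (insert x B) = S"
    proof
      show "span (insert x B) \<subseteq> S"
        using BT x(1) less.prems(1) by (intro span_minimal) (auto simp: T_def)
      show "S \<subseteq> span (insert x B)"
      proof
        fix s assume s: "s \<in> S"
        have "s - (x \<bullet> s) *\<^sub>R x \<in> T" unfolding T_def using s x(1) less.prems(1) \<open>x \<bullet> x = 1\<close>
          by (auto intro!: subspace_diff subspace_scale simp: inner_diff_right)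
        then show "s \<in> span (insert x B)" using B(4) by (auto simp: span_insert)
      qed
    qed
    ultimately show ?thesis using B(2,3) x(2,3) by (intro exI[of _ "insert x B"]) auto
  qed
qed

section \<open>Orthonormal bases and singular bases\<close>

text \<open>
  The members are numbered by natural numbers because the arguments below cut bases at the
  position of a singular value in the decreasing list.
\<close>

definition orthonormal_family :: "nat \<Rightarrow> (nat \<Rightarrow> 'a::real_inner) \<Rightarrow> bool" where
  "orthonormal_family n v \<longleftrightarrow> (\<forall>i<n. \<forall>j<n. v i \<bullet> v j = (if i = j then 1 else 0))"

lemma orthonormal_familyD:
  "orthonormal_family n v \<Longrightarrow> i < n \<Longrightarrow> j < n \<Longrightarrow> v i \<bullet> v j = (if i = j then 1 else 0)"
  by (simp add: orthonormal_family_def)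

lemma orthonormal_family_expand:
  fixes v :: "nat \<Rightarrow> 'a::euclidean_space"
  assumes v: "orthonormal_family DIM('a) v"
  shows "(\<Sum>i<DIM('a). (x \<bullet> v i) *\<^sub>R v i) = x"
proof -
  let ?B = "v ` {..<DIM('a)}"
  have inj: "inj_on v {..<DIM('a)}"
  proof (rule inj_onI)
    fix i j assume ij: "i \<in> {..<DIM('a)}" "j \<in> {..<DIM('a)}" "v i = v j"
    then have "v i \<bullet> v j = 1" using orthonormal_familyD[OF v, of j j] by simp
    then show "i = j" using orthonormal_familyD[OF v, of i j] ij by (auto split: if_splits)
  qed
  have orth: "pairwise orthogonal ?B"
    using orthonormal_familyD[OF v] by (auto simp: pairwise_def orthogonal_def)
  have nrm: "norm b = 1" if "b \<in> ?B" for b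
    using that orthonormal_familyD[OF v] by (auto simp: norm_eq_1)
  then have "0 \<notin> ?B" by force
  then have "independent ?B" using orth by (intro pairwise_orthogonal_independent)
  moreover have "card ?B = DIM('a)" using inj by (simp add: card_image)
  ultimately have "UNIV \<subseteq> span ?B" by (intro card_ge_dim_independent) auto
  then have "(\<Sum>b\<in>?B. (x \<bullet> b) *\<^sub>R b) = x"
    using orth nrm by (intro orthonormal_basis_expand) auto
  then show ?thesis using inj by (simp add: sum.reindex)
qed

lemma orthonormal_family_parseval:
  fixes v :: "nat \<Rightarrow> 'a::euclidean_space"
  assumes "orthonormal_family DIM('a) v"
  shows "x \<bullet> y = (\<Sum>i<DIM('a). (x \<bullet> v i) * (y \<bullet> v i))"
proof -
  have "x \<bullet> y = (\<Sum>i<DIM('a). (x \<bullet> v i) *\<^sub>R v i) \<bullet> y"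
    using orthonormal_family_expand[OF assms] by simp
  then show ?thesis by (simp only: inner_sum_left inner_scaleR_left inner_commute[of y])
qed

text \<open>
  Families of mutually orthogonal vectors of norm at most one, rather than exactly one, are
  allowed because the left singular vectors belonging to the singular value zero are taken to be
  zero below.
\<close>

lemma bessel_subunit:
  fixes u :: "nat \<Rightarrow> 'a::real_inner"
  assumes orth: "\<And>i j. i < q \<Longrightarrow> j < q \<Longrightarrow> i \<noteq> j \<Longrightarrow> u i \<bullet> u j = 0"
    and sub: "\<And>i. i < q \<Longrightarrow> u i \<bullet> u i \<le> 1"
  shows "(\<Sum>i<q. (u i \<bullet> z)\<^sup>2) \<le> z \<bullet> z"
proof -
  let ?p = "\<Sum>i<q. (u i \<bullet> z) *\<^sub>R u i"
  have pz: "?p \<bullet> z = (\<Sum>i<q. (u i \<bullet> z)\<^sup>2)" by (simp add: inner_sum_left power2_eq_square)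
  have "?p \<bullet> ?p = (\<Sum>i<q. (u i \<bullet> z) * (u i \<bullet> ?p))" by (simp add: inner_sum_left)
  also have "\<dots> = (\<Sum>i<q. (u i \<bullet> z)\<^sup>2 * (u i \<bullet> u i))"
  proof (rule sum.cong[OF refl])
    fix i assume i: "i \<in> {..<q}"
    have "u i \<bullet> ?p = (\<Sum>j<q. if j = i then (u i \<bullet> z) * (u i \<bullet> u i) else 0)"
      unfolding inner_sum_right using orth i by (intro sum.cong) auto
    also have "\<dots> = (u i \<bullet> z) * (u i \<bullet> u i)" using i by simp
    finally show "(u i \<bullet> z) * (u i \<bullet> ?p) = (u i \<bullet> z)\<^sup>2 * (u i \<bullet> u i)"
      by (simp add: power2_eq_square)
  qed
  also have "\<dots> \<le> (\<Sum>i<q. (u i \<bullet> z)\<^sup>2)"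
    using sub by (intro sum_mono mult_left_le) auto
  finally have pp: "?p \<bullet> ?p \<le> (\<Sum>i<q. (u i \<bullet> z)\<^sup>2)" .
  have "0 \<le> (z - ?p) \<bullet> (z - ?p)" by simp
  also have "\<dots> = z \<bullet> z - 2 * (?p \<bullet> z) + ?p \<bullet> ?p"
    by (simp only: inner_diff_left inner_diff_right inner_commute[of z ?p])
  finally show ?thesis using pp pz by linarith
qed

text \<open>
  The singular values are defined by the roots of a characteristic polynomial. The lemmas up to
  \<open>right_singular_basis_exists\<close> identify them with the square roots of the eigenvalues of an
  orthonormal eigenbasis of \<open>X\<^sup>T X\<close>, after which polynomials no longer matter.
\<close>

lemma gram_inner:
  fixes X :: "real^'n^'m"
  shows "((transpose X ** X) *v x) \<bullet> y = (X *v x) \<bullet> (X *v y)"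
  by (simp only: matrix_vector_mul_assoc[symmetric] transpose_matrix_vector dot_lmul_matrix)

lemma sum_const_poly: "(\<Sum>p\<in>S. [:g p:]) = [:\<Sum>p\<in>S. g p:]"
  by (induction rule: infinite_finite_induct) auto

lemma poly_det_const: "det (map_matrix (\<lambda>c. [:c:]) Q) = [:det Q:]" for Q :: "real^'n^'n"
proof -
  have "(\<Prod>i\<in>UNIV. [:f i:]) = [:\<Prod>i\<in>UNIV. f i:]" for f :: "'n \<Rightarrow> real"
    by (induction rule: infinite_finite_induct) (auto simp: one_pCons)
  moreover have "of_int z = [:of_int z :: real:]" for z :: int
    by (simp add: of_int_poly)
  ultimately show ?thesis
    by (simp add: det_def map_matrix_def sum_const_poly mult.commute)
qed

text \<open>
  With the eigenvectors as the columns of \<open>Q\<close>, the eigenvalue equations say \<open>(x I - M) Q = Q D\<close> over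
  the polynomial ring, where \<open>D\<close> is diagonal with entries \<open>x - c\<^sub>i\<close>. Taking determinants and
  cancelling the nonzero constant \<open>det Q\<close> gives the factorisation, with multiplicities.
\<close>

lemma charpoly_of_eigenbasis:
  fixes M :: "real^'n^'n" and w :: "'n \<Rightarrow> real^'n"
  assumes orth: "\<And>i j. w i \<bullet> w j = (if i = j then 1 else 0)"
    and eig: "\<And>i. M *v w i = c i *\<^sub>R w i"
  shows "charpoly M = (\<Prod>i\<in>UNIV. [:- c i, 1:])"
proof -
  define Q :: "real^'n^'n" where "Q = (\<chi> i j. w j $ i)"
  define D :: "real poly^'n^'n" where "D = (\<chi> i j. if i = j then [:- c i, 1:] else 0)"
  let ?Q = "map_matrix (\<lambda>c. [:c:]) Q"
  have "transpose Q ** Q = mat 1"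
    using orth by (simp add: vec_eq_iff matrix_matrix_mult_def transpose_def Q_def mat_def inner_vec_def)
  then have "det Q * det Q = 1" by (metis det_I det_mul det_transpose)
  then have Q0: "det ?Q \<noteq> 0" by (auto simp: poly_det_const)
  have MQ: "(\<Sum>k\<in>UNIV. M $ i $ k * w j $ k) = c j * w j $ i" for i j
    using eig[of j] by (simp add: vec_eq_iff matrix_vector_mult_def)
  have "(mat [:0, 1:] - map_matrix (\<lambda>c. [:c:]) M) ** ?Q = ?Q ** D"
  proof -
    have "(\<Sum>k\<in>UNIV. ((if i = k then [:0, 1:] else 0) - [:M $ i $ k:]) * [:w j $ k:])
        = (\<Sum>k\<in>UNIV. [:w k $ i:] * (if k = j then [:- c k, 1:] else 0))" for i j
    proof -
      have "(\<Sum>k\<in>UNIV. ((if i = k then [:0, 1:] else 0) - [:M $ i $ k:]) * [:w j $ k:])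
          = (\<Sum>k\<in>UNIV. (if i = k then [:0, w j $ k:] else 0)) - (\<Sum>k\<in>UNIV. [:M $ i $ k * w j $ k:])"
        unfolding sum_subtractf[symmetric] by (intro sum.cong) (auto simp: algebra_simps)
      also have "\<dots> = [:- (c j * w j $ i), w j $ i:]" by (simp add: sum_const_poly MQ)
      also have "\<dots> = (\<Sum>k\<in>UNIV. if k = j then [:w k $ i:] * [:- c k, 1:] else 0)"
        by (simp add: mult.commute)
      also have "\<dots> = (\<Sum>k\<in>UNIV. [:w k $ i:] * (if k = j then [:- c k, 1:] else 0))"
        by (intro sum.cong) auto
      finally show ?thesis .
    qed
    then show ?thesis
      by (simp add: vec_eq_iff matrix_matrix_mult_def mat_def Q_def D_def map_matrix_def)
  qed
  then have "charpoly M * det ?Q = det ?Q * det D"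
    by (metis charpoly_def det_mul)
  then have "charpoly M = det D" using Q0 by (simp add: mult.commute)
  also have "\<dots> = (\<Prod>i\<in>UNIV. [:- c i, 1:])"
    by (subst det_diagonal) (auto simp: D_def)
  finally show ?thesis .
qed

text \<open>
  A right singular basis diagonalises \<open>X\<^sup>T X\<close>; the entries are stated through the images
  \<open>X v\<^sub>i\<close>, since only these inner products are used afterwards.
\<close>

definition right_singular_basis :: "real^'n^'m \<Rightarrow> (nat \<Rightarrow> real^'n) \<Rightarrow> bool" where
  "right_singular_basis X v \<longleftrightarrow> orthonormal_family CARD('n) v \<and>
    (\<forall>i<CARD('n). \<forall>j<CARD('n).
      (X *v v i) \<bullet> (X *v v j) = (if i = j then (singular_values X ! i)\<^sup>2 else 0))"

lemma right_singular_basis_orthonormal: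
  "right_singular_basis X v \<Longrightarrow> orthonormal_family CARD('n) v" for X :: "real^'n^'m"
  by (simp add: right_singular_basis_def)

lemma right_singular_basis_inner:
  fixes X :: "real^'n^'m"
  assumes "right_singular_basis X v" "i < CARD('n)" "j < CARD('n)"
  shows "(X *v v i) \<bullet> (X *v v j) = (if i = j then (singular_values X ! i)\<^sup>2 else 0)"
  using assms unfolding right_singular_basis_def by blast

lemma
  fixes X :: "real^'n^'m"
  shows length_singular_values: "length (singular_values X) = CARD('n)"
    and singular_values_nonneg: "i < CARD('n) \<Longrightarrow> singular_values X ! i \<ge> 0"
    and right_singular_basis_exists: "\<exists>v. right_singular_basis X v"
proof -
  let ?n = "CARD('n)"
  define G where "G = transpose X ** X"
  have G: "(G *v x) \<bullet> y = (X *v x) \<bullet> (X *v y)" for x y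
    unfolding G_def by (rule gram_inner)
  have adj: "(G *v x) \<bullet> y = x \<bullet> (G *v y)" for x y
    using G[of x y] G[of y x] by (simp add: inner_commute)
  from self_adjoint_orthonormal_eigenbasis[OF matrix_vector_mul_linear adj subspace_UNIV] obtain B where
    B: "pairwise orthogonal B" "\<forall>x\<in>B. norm x = 1" "\<forall>x\<in>B. \<exists>c. G *v x = c *\<^sub>R x" "span B = UNIV"
    by blast
  have "0 \<notin> B" using B(2) by force
  with B(1) have ind: "independent B" by (rule pairwise_orthogonal_independent)
  then have finB: "finite B" by (rule independent_imp_finite)
  have cardB: "card B = ?n"
    using ind B(4) by (metis dim_UNIV DIM_cart DIM_real dim_eq_card mult.right_neutral span_UNIV)
  obtain xs0 where xs0: "set xs0 = B" "distinct xs0" using finite_distinct_list[OF finB] by blast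
  \<comment> \<open>Sorting the eigenvectors by their eigenvalues makes the numbering of the basis agree with
    that of the singular values.\<close>
  define ev where "ev x = (G *v x) \<bullet> x" for x
  define xs where "xs = rev (sort_key ev xs0)"
  have xs: "set xs = B" "distinct xs" "length xs = ?n"
    using xs0 distinct_card[OF xs0(2)] cardB by (auto simp: xs_def)
  have inner_xs: "xs ! i \<bullet> xs ! j = (if i = j then 1 else 0)" if "i < ?n" "j < ?n" for i j
  proof -
    have "xs ! i \<in> B" "xs ! j \<in> B" using that xs nth_mem[of _ xs] by auto
    then show ?thesis using B(1,2) that xs nth_eq_iff_index_eq[OF xs(2), of i j]
      by (auto simp: norm_eq_1 pairwise_def orthogonal_def)
  qed
  have eig: "G *v x = ev x *\<^sub>R x" if "x \<in> B" for x
  proof -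
    from bspec[OF B(3) that] obtain c where c: "G *v x = c *\<^sub>R x" ..
    then have "ev x = c" using B(2) that by (auto simp: ev_def norm_eq_1)
    with c show ?thesis by simp
  qed
  have ev0: "ev x \<ge> 0" for x by (simp add: ev_def G)
  obtain e where e: "bij_betw e (UNIV :: 'n set) {..<?n}"
    using ex_bij_betw_finite_nat[of "UNIV :: 'n set"] by (auto simp: atLeast0LessThan)
  have elt: "e i < ?n" for i using bij_betwE[OF e] by auto
  have einj: "e i = e j \<longleftrightarrow> i = j" for i j using bij_betw_imp_inj_on[OF e] by (auto simp: inj_on_def)
  have "charpoly G = (\<Prod>i\<in>UNIV. [:- ev (xs ! e i), 1:])"
  proof (rule charpoly_of_eigenbasis[where w = "\<lambda>i. xs ! e i"])
    show "xs ! e i \<bullet> xs ! e j = (if i = j then 1 else 0)" for i j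
      using inner_xs[OF elt elt, of i j] by (simp add: einj)
    show "G *v (xs ! e i) = ev (xs ! e i) *\<^sub>R (xs ! e i)" for i
      using elt[of i] xs nth_mem[of "e i" xs] by (intro eig) auto
  qed
  then have "proots (charpoly G) = (\<Sum>i\<in>UNIV. {#ev (xs ! e i)#})"
    by (simp add: proots_prod)
  also have "\<dots> = image_mset (\<lambda>i. ev (xs ! i)) (image_mset e (mset_set UNIV))"
    by (simp add: sum_unfold_sum_mset multiset.map_comp o_def)
  also have "image_mset e (mset_set UNIV) = mset_set {..<?n}"
    using e by (simp add: image_mset_mset_set bij_betw_def)
  also have "image_mset (\<lambda>i. ev (xs ! i)) (mset_set {..<?n}) = mset (map (\<lambda>i. ev (xs ! i)) [0..<?n])"
    by (simp add: atLeast0LessThan)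
  also have "map (\<lambda>i. ev (xs ! i)) [0..<?n] = map ev xs"
    using xs(3) by (intro nth_equalityI) auto
  finally have pr: "proots (charpoly G) = mset (map ev xs)" .
  let ?l = "map (\<lambda>x. sqrt (ev x)) (sort_key ev xs0)"
  have "mset (map ev xs) = mset (map ev (sort_key ev xs0))" by (simp add: xs_def)
  then have "singular_values X = rev (sort ?l)"
    unfolding singular_values_def G_def[symmetric] pr
    by (simp flip: mset_map add: multiset.map_comp o_def del: mset_map sort_key_simps)
  also have "sort ?l = ?l"
  proof -
    have "sorted (map ev (sort_key ev xs0))" by (rule sorted_sort_key)
    then have "sorted ?l" unfolding sorted_map by simp
    then show ?thesis by (rule sort_key_id_if_sorted[OF _, of "\<lambda>x. x", simplified])
  qed
  finally have sv: "singular_values X = map (\<lambda>x. sqrt (ev x)) xs"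
    by (simp add: xs_def rev_map)
  show len: "length (singular_values X) = ?n" using sv xs(3) by simp
  show "singular_values X ! i \<ge> 0" if "i < ?n" for i using sv xs(3) ev0 that by simp
  have "(X *v (xs ! i)) \<bullet> (X *v (xs ! j)) = (if i = j then (singular_values X ! i)\<^sup>2 else 0)"
    if "i < ?n" "j < ?n" for i j
  proof -
    have "xs ! i \<in> B" using that xs nth_mem[of i xs] by auto
    then have "(X *v (xs ! i)) \<bullet> (X *v (xs ! j)) = ev (xs ! i) * (xs ! i \<bullet> xs ! j)"
      by (simp add: eig flip: G)
    then show ?thesis using inner_xs[OF that] sv xs(3) that ev0 by simp
  qed
  then show "\<exists>v. right_singular_basis X v"
    unfolding right_singular_basis_def orthonormal_family_def using inner_xs by blast
qed

lemma singular_values_antimono: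
  fixes X :: "real^'n^'m"
  assumes "i \<le> j" "j < CARD('n)"
  shows "singular_values X ! j \<le> singular_values X ! i"
proof -
  have "sorted_wrt (\<ge>) (singular_values X)"
    unfolding singular_values_def sorted_wrt_rev by (rule sorted_sorted_list_of_multiset)
  then show ?thesis using assms length_singular_values[of X]
    by (cases "i = j") (auto simp: sorted_wrt_iff_nth_less)
qed

section \<open>Norms in terms of singular values\<close>

text \<open>
  The Frobenius inner product is \<open>trace (X\<^sup>T Y)\<close>, which may be computed in any orthonormal basis.
\<close>

lemma inner_matrix_orthonormal:
  fixes X Y :: "real^'n^'m"
  assumes v: "orthonormal_family CARD('n) v"
  shows "X \<bullet> Y = (\<Sum>i<CARD('n). (X *v v i) \<bullet> (Y *v v i))"
proof -
  have dim: "DIM(real^'n) = CARD('n)" by simp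
  have "X \<bullet> Y = (\<Sum>r\<in>UNIV. X $ r \<bullet> Y $ r)" by (simp add: inner_vec_def)
  also have "\<dots> = (\<Sum>r\<in>UNIV. \<Sum>i<CARD('n). (X $ r \<bullet> v i) * (Y $ r \<bullet> v i))"
    by (intro sum.cong refl orthonormal_family_parseval[of v, unfolded dim] v)
  also have "\<dots> = (\<Sum>i<CARD('n). \<Sum>r\<in>UNIV. (X $ r \<bullet> v i) * (Y $ r \<bullet> v i))"
    by (rule sum.swap)
  also have "\<dots> = (\<Sum>i<CARD('n). (X *v v i) \<bullet> (Y *v v i))"
    by (intro sum.cong refl) (simp add: inner_vec_def[of "X *v _"] matrix_vector_mul_component)
  finally show ?thesis .
qed

lemma frobenius_norm_singular_values:
  fixes X :: "real^'n^'m"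
  shows "(frobenius_norm X)\<^sup>2 = (\<Sum>i<CARD('n). (singular_values X ! i)\<^sup>2)"
proof -
  obtain v where v: "right_singular_basis X v" using right_singular_basis_exists[of "X"] ..
  have "(frobenius_norm X)\<^sup>2 = X \<bullet> X" by (simp add: frobenius_norm_eq_norm power2_norm_eq_inner)
  also have "\<dots> = (\<Sum>i<CARD('n). (X *v v i) \<bullet> (X *v v i))"
    by (rule inner_matrix_orthonormal[OF right_singular_basis_orthonormal[OF v]])
  also have "\<dots> = (\<Sum>i<CARD('n). (singular_values X ! i)\<^sup>2)"
    by (intro sum.cong) (simp_all add: right_singular_basis_inner[OF v])
  finally show ?thesis .
qed

lemma norm_mult_singular_basis:
  fixes X :: "real^'n^'m"
  assumes v: "right_singular_basis X v"
  shows "(norm (X *v x))\<^sup>2 = (\<Sum>i<CARD('n). (singular_values X ! i)\<^sup>2 * (x \<bullet> v i)\<^sup>2)"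
proof -
  let ?n = "CARD('n)"
  have v1: "orthonormal_family DIM(real^'n) v" using right_singular_basis_orthonormal[OF v] by simp
  have "X *v x = X *v (\<Sum>i<?n. (x \<bullet> v i) *\<^sub>R v i)"
    using orthonormal_family_expand[OF v1, of x] by simp
  also have "\<dots> = (\<Sum>i<?n. (x \<bullet> v i) *\<^sub>R (X *v v i))"
    by (simp add: linear_sum[OF matrix_vector_mul_linear] linear_cmul[OF matrix_vector_mul_linear])
  finally have X: "X *v x = (\<Sum>i<?n. (x \<bullet> v i) *\<^sub>R (X *v v i))" .
  have "(X *v x) \<bullet> (X *v x)
      = (\<Sum>i<?n. \<Sum>j<?n. (x \<bullet> v i) * ((x \<bullet> v j) * ((X *v v j) \<bullet> (X *v v i))))"
    unfolding X by (simp add: inner_sum_left inner_sum_right sum_distrib_left)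
  also have "\<dots> = (\<Sum>i<?n. \<Sum>j<?n. if j = i then (singular_values X ! i)\<^sup>2 * (x \<bullet> v i)\<^sup>2 else 0)"
  proof (intro sum.cong refl)
    fix i j assume "i \<in> {..<?n}" "j \<in> {..<?n}"
    then show "(x \<bullet> v i) * ((x \<bullet> v j) * ((X *v v j) \<bullet> (X *v v i)))
        = (if j = i then (singular_values X ! i)\<^sup>2 * (x \<bullet> v i)\<^sup>2 else 0)"
      by (simp add: right_singular_basis_inner[OF v] power2_eq_square)
  qed
  also have "\<dots> = (\<Sum>i<?n. (singular_values X ! i)\<^sup>2 * (x \<bullet> v i)\<^sup>2)"
    by (intro sum.cong refl) simp
  finally show ?thesis by (simp add: power2_norm_eq_inner)
qed

lemma norm_sq_singular_basis:
  fixes X :: "real^'n^'m"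
  assumes v: "right_singular_basis X v"
  shows "(norm x)\<^sup>2 = (\<Sum>i<CARD('n). (x \<bullet> v i)\<^sup>2)"
  unfolding power2_norm_eq_inner unfolding power2_eq_square
  using orthonormal_family_parseval[of v x x] right_singular_basis_orthonormal[OF v] by simp

text \<open>
  This bound and the next one are the two halves of the Courant--Fischer principle: \<open>X\<close> stretches
  by at most the entry \<open>j\<close> of the list orthogonally to the first \<open>j\<close> singular vectors, and by at
  least that entry on the span of the first \<open>j + 1\<close>.
\<close>

lemma norm_mult_le_singular_value:
  fixes X :: "real^'n^'m"
  assumes v: "right_singular_basis X v" and j: "j < CARD('n)"
    and orth: "\<And>i. i < j \<Longrightarrow> x \<bullet> v i = 0"
  shows "norm (X *v x) \<le> singular_values X ! j * norm x"
proof (rule power2_le_imp_le)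
  show "(norm (X *v x))\<^sup>2 \<le> (singular_values X ! j * norm x)\<^sup>2"
    unfolding norm_mult_singular_basis[OF v] power_mult_distrib norm_sq_singular_basis[OF v]
      sum_distrib_left
  proof (rule sum_mono)
    fix i assume i: "i \<in> {..<CARD('n)}"
    show "(singular_values X ! i)\<^sup>2 * (x \<bullet> v i)\<^sup>2 \<le> (singular_values X ! j)\<^sup>2 * (x \<bullet> v i)\<^sup>2"
    proof (cases "i < j")
      case False
      then show ?thesis using i j
        by (intro mult_right_mono power_mono singular_values_antimono singular_values_nonneg) auto
    qed (simp add: orth)
  qed
qed (use singular_values_nonneg[OF j, of X] in simp)

lemma norm_mult_ge_singular_value:
  fixes X :: "real^'n^'m"
  assumes v: "right_singular_basis X v" and j: "j < CARD('n)"
    and orth: "\<And>i. j < i \<Longrightarrow> i < CARD('n) \<Longrightarrow> x \<bullet> v i = 0"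
  shows "singular_values X ! j * norm x \<le> norm (X *v x)"
proof (rule power2_le_imp_le)
  show "(singular_values X ! j * norm x)\<^sup>2 \<le> (norm (X *v x))\<^sup>2"
    unfolding norm_mult_singular_basis[OF v] power_mult_distrib norm_sq_singular_basis[OF v]
      sum_distrib_left
  proof (rule sum_mono)
    fix i assume i: "i \<in> {..<CARD('n)}"
    show "(singular_values X ! j)\<^sup>2 * (x \<bullet> v i)\<^sup>2 \<le> (singular_values X ! i)\<^sup>2 * (x \<bullet> v i)\<^sup>2"
    proof (cases "j < i")
      case False
      then show ?thesis using i j
        by (intro mult_right_mono power_mono singular_values_antimono singular_values_nonneg) auto
    qed (use i orth in simp)
  qed
qed simp

lemma spectral_norm_le_singular_value:
  fixes X :: "real^'n^'m"
  shows "spectral_norm X \<le> singular_values X ! 0"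
proof -
  obtain v where v: "right_singular_basis X v" using right_singular_basis_exists[of "X"] ..
  show ?thesis unfolding spectral_norm_def
    by (rule onorm_le) (rule norm_mult_le_singular_value[OF v], auto)
qed

section \<open>Weyl's inequality for perturbations of bounded rank\<close>

lemma nonzero_vector_orthogonal_to_few:
  fixes C :: "'a::euclidean_space set"
  assumes "finite C" "card C < DIM('a)"
  shows "\<exists>x. x \<noteq> 0 \<and> (\<forall>c\<in>C. x \<bullet> c = 0)"
proof -
  have "dim C < DIM('a)" using dim_le_card'[OF assms(1)] assms(2) by linarith
  then obtain x where x: "x \<noteq> 0" "\<And>y. y \<in> span C \<Longrightarrow> orthogonal x y"
    using orthogonal_to_subspace_exists by blast
  then show ?thesis using span_base[of _ C] by (auto simp: orthogonal_def)
qed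

text \<open>
  Some nonzero \<open>x\<close> is annihilated by \<open>B\<close>, lies in the span of the first \<open>j + k + 1\<close> singular vectors
  of \<open>A\<close>, and is orthogonal to the first \<open>j\<close> singular vectors of \<open>A - B\<close>: these conditions are
  orthogonality to at most \<open>k + (n - j - k - 1) + j = n - 1\<close> vectors. On such an \<open>x\<close> the maps \<open>A\<close> and
  \<open>A - B\<close> agree, which compares their stretching factors.
\<close>

lemma singular_value_rank_perturbation:
  fixes A B :: "real^'n^'m"
  assumes rk: "rank B \<le> k" and jk: "j + k < CARD('n)"
  shows "singular_values A ! (j + k) \<le> singular_values (A - B) ! j"
proof -
  let ?n = "CARD('n)"
  obtain v where v: "right_singular_basis A v" using right_singular_basis_exists[of "A"] ..
  obtain w where w: "right_singular_basis (A - B) w" using right_singular_basis_exists[of "(A - B)"] ..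
  obtain R where R: "R \<subseteq> rows B" "independent R" "rows B \<subseteq> span R" "card R = dim (rows B)"
    using basis_exists by blast
  have finR: "finite R" using R(2) by (rule independent_imp_finite)
  have cardR: "card R \<le> k" using R(4) rk by (simp add: row_rank_def dim_vec_eq)
  let ?C = "v ` {j + k<..<?n} \<union> w ` {..<j} \<union> R"
  have "card ?C \<le> card (v ` {j + k<..<?n}) + card (w ` {..<j}) + card R"
    by (meson card_Un_le add_mono le_refl order_trans)
  also have "\<dots> \<le> (?n - Suc (j + k)) + j + k"
    using card_image_le[of "{j + k<..<?n}" v] card_image_le[of "{..<j}" w] cardR by simp
  also have "\<dots> < ?n" using jk by simp
  finally have "card ?C < DIM(real^'n)" by simp
  moreover have "finite ?C" using finR by simp
  ultimately have "\<exists>x. x \<noteq> 0 \<and> (\<forall>c\<in>?C. x \<bullet> c = 0)"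
    by (intro nonzero_vector_orthogonal_to_few)
  then obtain x where x: "x \<noteq> 0" "\<And>c. c \<in> ?C \<Longrightarrow> x \<bullet> c = 0"
    by (elim exE conjE) simp
  have "row i B \<in> span R" for i using R(3) by (auto simp: rows_def)
  then have "orthogonal x (row i B)" for i
    by (rule orthogonal_to_span) (use x(2) in \<open>auto simp: orthogonal_def\<close>)
  then have "B *v x = 0"
    by (simp add: vec_eq_iff matrix_mult_dot row_def orthogonal_def inner_commute)
  then have "A *v x = (A - B) *v x" by (simp add: matrix_vector_mult_diff_rdistrib)
  moreover have "singular_values A ! (j + k) * norm x \<le> norm (A *v x)"
    using jk x(2) by (intro norm_mult_ge_singular_value[OF v]) auto
  moreover have "norm ((A - B) *v x) \<le> singular_values (A - B) ! j * norm x"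
    using jk x(2) by (intro norm_mult_le_singular_value[OF w]) auto
  ultimately have "singular_values A ! (j + k) * norm x \<le> singular_values (A - B) ! j * norm x"
    by (metis order_trans)
  then show ?thesis using x(1) by simp
qed

lemma singular_values_zero:
  assumes "i < CARD('n)"
  shows "singular_values (0 :: real^'n^'m) ! i = 0"
proof -
  have "(\<Sum>i<CARD('n). (singular_values (0 :: real^'n^'m) ! i)\<^sup>2) = 0"
    using frobenius_norm_singular_values[of "0 :: real^'n^'m"] by (simp add: frobenius_norm_eq_norm)
  then show ?thesis using assms by (simp add: sum_nonneg_eq_0_iff)
qed

text \<open>
  The rank perturbation bound with \<open>A = B\<close> compares the singular values of \<open>B\<close> with those of \<open>B - B\<close>.
\<close>

lemma singular_values_beyond_rank:
  fixes B :: "real^'n^'m"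
  assumes "rank B \<le> k" "k \<le> i" "i < CARD('n)"
  shows "singular_values B ! i = 0"
proof (rule antisym)
  have "singular_values B ! i \<le> singular_values (B - B) ! (i - k)"
    using singular_value_rank_perturbation[OF assms(1), of "i - k" B] assms(2,3) by simp
  also have "\<dots> = singular_values (0 :: real^'n^'m) ! (i - k)" by simp
  also have "\<dots> = 0" using assms(3) by (intro singular_values_zero) simp
  finally show "singular_values B ! i \<le> 0" .
qed (rule singular_values_nonneg[OF assms(3)])

section \<open>Von Neumann's trace inequality\<close>

text \<open>
  Summation by parts: the sum rearranges into nonnegative multiples of partial sums of \<open>d\<close>. Keeping
  the term with the full sum as the lower bound makes the induction go through.
\<close>

lemma abel_sum_lower_bound:
  fixes s d :: "nat \<Rightarrow> real"
  assumes "\<And>i. i < n \<Longrightarrow> s (Suc i) \<le> s i"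
    and "\<And>p. p \<le> n \<Longrightarrow> 0 \<le> (\<Sum>i<p. d i)"
  shows "s n * (\<Sum>i<Suc n. d i) \<le> (\<Sum>i<Suc n. s i * d i)"
  using assms
proof (induction n)
  case (Suc n)
  have "s (Suc n) * (\<Sum>i<Suc n. d i) \<le> s n * (\<Sum>i<Suc n. d i)"
    using Suc.prems(1)[of n] Suc.prems(2)[of "Suc n"] by (intro mult_right_mono) simp_all
  also have "\<dots> \<le> (\<Sum>i<Suc n. s i * d i)"
    using Suc.prems by (intro Suc.IH) auto
  finally show ?case by (simp add: algebra_simps)
qed simp

lemma weighted_sum_mono_of_partial_sums:
  fixes s a b :: "nat \<Rightarrow> real"
  assumes dec: "\<And>i j. i \<le> j \<Longrightarrow> j < n \<Longrightarrow> s j \<le> s i" and nonneg: "\<And>i. i < n \<Longrightarrow> 0 \<le> s i"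
    and partial: "\<And>p. p \<le> n \<Longrightarrow> (\<Sum>i<p. a i) \<le> (\<Sum>i<p. b i)"
  shows "(\<Sum>i<n. s i * a i) \<le> (\<Sum>i<n. s i * b i)"
proof (cases n)
  case (Suc m)
  have "0 \<le> s m * (\<Sum>i<Suc m. b i - a i)"
    using nonneg[of m] partial[of n] Suc by (intro mult_nonneg_nonneg) (auto simp: sum_subtractf)
  also have "\<dots> \<le> (\<Sum>i<Suc m. s i * (b i - a i))"
    using dec partial Suc by (intro abel_sum_lower_bound) (auto simp: sum_subtractf)
  finally show ?thesis by (simp add: Suc sum_subtractf right_diff_distrib)
qed simp

text \<open>
  In the Birkhoff picture the maximum over doubly substochastic matrices is attained at the
  identity, because both weight sequences decrease. Two summations by parts prove this directly:
  they reduce the claim to the sums of \<open>M\<close> over initial \<open>p \<times> q\<close> blocks, each at most \<open>min p q\<close>.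
\<close>

lemma doubly_substochastic_sum_le:
  fixes s t :: "nat \<Rightarrow> real" and M :: "nat \<Rightarrow> nat \<Rightarrow> real"
  assumes s: "\<And>i j. i \<le> j \<Longrightarrow> j < n \<Longrightarrow> s j \<le> s i" "\<And>i. i < n \<Longrightarrow> 0 \<le> s i"
    and t: "\<And>i j. i \<le> j \<Longrightarrow> j < n \<Longrightarrow> t j \<le> t i" "\<And>i. i < n \<Longrightarrow> 0 \<le> t i"
    and rows: "\<And>i q. i < n \<Longrightarrow> q \<le> n \<Longrightarrow> (\<Sum>j<q. M i j) \<le> 1"
    and cols: "\<And>j p. j < n \<Longrightarrow> p \<le> n \<Longrightarrow> (\<Sum>i<p. M i j) \<le> 1"
  shows "(\<Sum>i<n. \<Sum>j<n. s i * t j * M i j) \<le> (\<Sum>i<n. s i * t i)"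
proof -
  have "(\<Sum>i<n. s i * (\<Sum>j<n. t j * M i j)) \<le> (\<Sum>i<n. s i * t i)"
  proof (rule weighted_sum_mono_of_partial_sums[OF s])
    fix p assume p: "p \<le> n"
    have "(\<Sum>i<p. \<Sum>j<n. t j * M i j) = (\<Sum>j<n. t j * (\<Sum>i<p. M i j))"
      by (subst sum.swap) (simp add: sum_distrib_left)
    also have "\<dots> \<le> (\<Sum>j<n. t j * (if j < p then 1 else 0))"
    proof (rule weighted_sum_mono_of_partial_sums[OF t])
      fix q assume q: "q \<le> n"
      have "(\<Sum>j<q. \<Sum>i<p. M i j) \<le> (\<Sum>j<q. 1)"
        using q p by (intro sum_mono cols) auto
      moreover have "(\<Sum>j<q. \<Sum>i<p. M i j) \<le> (\<Sum>i<p. 1)"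
        using q p by (subst sum.swap) (intro sum_mono rows, auto)
      moreover have "(\<Sum>j<q. if j < p then 1 else 0 :: real) = real (card ({..<q} \<inter> {..<p}))"
        by (simp add: sum.If_cases lessThan_def Collect_conj_eq)
      moreover have "{..<q} \<inter> {..<p} = {..<min p q}" by auto
      ultimately show "(\<Sum>j<q. \<Sum>i<p. M i j) \<le> (\<Sum>j<q. if j < p then 1 else 0)"
        by (simp add: min_def)
    qed
    also have "\<dots> = (\<Sum>j\<in>{..<n} \<inter> {j. j < p}. t j)"
      by (simp add: sum.inter_restrict mult.commute if_distrib cong: if_cong)
    also have "{..<n} \<inter> {j. j < p} = {..<p}" using p by auto
    finally show "(\<Sum>i<p. \<Sum>j<n. t j * M i j) \<le> (\<Sum>i<p. t i)" .
  qed auto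
  then show ?thesis by (simp add: sum_distrib_left mult.assoc)
qed

text \<open>
  Where the singular value is zero, \<open>inverse 0 = 0\<close> makes the left singular vector zero. It then has
  norm zero instead of one, which is enough for Bessel's inequality, and no orthonormal
  completion in the codomain has to be chosen.
\<close>

lemma left_singular_family:
  fixes X :: "real^'n^'m"
  assumes v: "right_singular_basis X v"
  obtains u where "\<And>i. i < CARD('n) \<Longrightarrow> X *v v i = singular_values X ! i *\<^sub>R u i"
    and "\<And>i j. i < CARD('n) \<Longrightarrow> j < CARD('n) \<Longrightarrow> i \<noteq> j \<Longrightarrow> u i \<bullet> u j = 0"
    and "\<And>i. i < CARD('n) \<Longrightarrow> u i \<bullet> u i \<le> 1"
proof
  let ?u = "\<lambda>i. inverse (singular_values X ! i) *\<^sub>R (X *v v i)"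
  have e: "(X *v v i) \<bullet> (X *v v j) = (if i = j then (singular_values X ! i)\<^sup>2 else 0)"
    if "i < CARD('n)" "j < CARD('n)" for i j
    using right_singular_basis_inner[OF v that] .
  show "X *v v i = singular_values X ! i *\<^sub>R ?u i" if "i < CARD('n)" for i
    using e[OF that that] by (cases "singular_values X ! i = 0") auto
  show "?u i \<bullet> ?u j = 0" if "i < CARD('n)" "j < CARD('n)" "i \<noteq> j" for i j
    using e[OF that(1,2)] that(3) by simp
  show "?u i \<bullet> ?u i \<le> 1" if "i < CARD('n)" for i
    using e[OF that that] by (cases "singular_values X ! i = 0") (auto simp: field_simps power2_eq_square)
qed

text \<open>
  Expanding both matrices in their singular vectors gives
  \<open>X \<bullet> Y = (\<Sum>i j. \<sigma>\<^sub>i \<tau>\<^sub>j (v\<^sub>i \<bullet> w\<^sub>j) (x\<^sub>i \<bullet> y\<^sub>j))\<close>. The arithmetic-geometric mean inequality replaces the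
  product of the two inner products by the mean \<open>M\<close> of their squares, and by Bessel's inequality
  \<open>M\<close> is doubly substochastic.
\<close>

lemma von_neumann_trace_inequality:
  fixes X Y :: "real^'n^'m"
  shows "X \<bullet> Y \<le> (\<Sum>i<CARD('n). singular_values X ! i * singular_values Y ! i)"
proof -
  let ?n = "CARD('n)" and ?s = "\<lambda>i. singular_values X ! i" and ?t = "\<lambda>i. singular_values Y ! i"
  obtain v where v: "right_singular_basis X v" using right_singular_basis_exists[of "X"] ..
  obtain w where w: "right_singular_basis Y w" using right_singular_basis_exists[of "Y"] ..
  have vo: "orthonormal_family ?n v" and wo: "orthonormal_family ?n w"
    using right_singular_basis_orthonormal[OF v] right_singular_basis_orthonormal[OF w] .
  obtain x where x: "\<And>i. i < ?n \<Longrightarrow> X *v v i = ?s i *\<^sub>R x i"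
    "\<And>i j. i < ?n \<Longrightarrow> j < ?n \<Longrightarrow> i \<noteq> j \<Longrightarrow> x i \<bullet> x j = 0" "\<And>i. i < ?n \<Longrightarrow> x i \<bullet> x i \<le> 1"
    by (rule left_singular_family[OF v]) blast
  obtain y where y: "\<And>i. i < ?n \<Longrightarrow> Y *v w i = ?t i *\<^sub>R y i"
    "\<And>i j. i < ?n \<Longrightarrow> j < ?n \<Longrightarrow> i \<noteq> j \<Longrightarrow> y i \<bullet> y j = 0" "\<And>i. i < ?n \<Longrightarrow> y i \<bullet> y i \<le> 1"
    by (rule left_singular_family[OF w]) blast
  define M where "M i j = ((v i \<bullet> w j)\<^sup>2 + (x i \<bullet> y j)\<^sup>2) / 2" for i j
  have Yv: "Y *v v i = (\<Sum>j<?n. ((v i \<bullet> w j) * ?t j) *\<^sub>R y j)" for i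
  proof -
    have "Y *v v i = Y *v (\<Sum>j<?n. (v i \<bullet> w j) *\<^sub>R w j)"
      using orthonormal_family_expand[of w "v i"] wo by simp
    also have "\<dots> = (\<Sum>j<?n. (v i \<bullet> w j) *\<^sub>R (Y *v w j))"
      by (simp add: linear_sum[OF matrix_vector_mul_linear] linear_cmul[OF matrix_vector_mul_linear])
    also have "\<dots> = (\<Sum>j<?n. ((v i \<bullet> w j) * ?t j) *\<^sub>R y j)"
      using y(1) by (intro sum.cong) auto
    finally show ?thesis .
  qed
  have "X \<bullet> Y = (\<Sum>i<?n. (X *v v i) \<bullet> (Y *v v i))" by (rule inner_matrix_orthonormal[OF vo])
  also have "\<dots> = (\<Sum>i<?n. \<Sum>j<?n. (?s i * ?t j) * ((v i \<bullet> w j) * (x i \<bullet> y j)))"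
    using x(1) by (intro sum.cong refl) (simp add: Yv inner_sum_right sum_distrib_left mult_ac)
  also have "\<dots> \<le> (\<Sum>i<?n. \<Sum>j<?n. ?s i * ?t j * M i j)"
  proof (intro sum_mono mult_left_mono)
    fix i j assume ij: "i \<in> {..<?n}" "j \<in> {..<?n}"
    show "(v i \<bullet> w j) * (x i \<bullet> y j) \<le> M i j"
      using sum_squares_bound[of "v i \<bullet> w j" "x i \<bullet> y j"] by (simp add: M_def)
    show "0 \<le> ?s i * ?t j" using ij by (simp add: singular_values_nonneg)
  qed
  also have "\<dots> \<le> (\<Sum>i<?n. ?s i * ?t i)"
  proof (rule doubly_substochastic_sum_le)
    have vv: "v i \<bullet> v i \<le> 1" "w i \<bullet> w i \<le> 1" if "i < ?n" for i
      using orthonormal_familyD[OF vo that that] orthonormal_familyD[OF wo that that] by auto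
    show "(\<Sum>j<q. M i j) \<le> 1" if "i < ?n" "q \<le> ?n" for i q
    proof -
      have "(\<Sum>j<q. (w j \<bullet> v i)\<^sup>2) \<le> v i \<bullet> v i"
        using that orthonormal_familyD[OF wo] by (intro bessel_subunit) auto
      moreover have "(\<Sum>j<q. (y j \<bullet> x i)\<^sup>2) \<le> x i \<bullet> x i"
        using that y by (intro bessel_subunit) auto
      ultimately show ?thesis using vv[OF that(1)] x(3)[OF that(1)]
        by (simp add: M_def sum.distrib inner_commute flip: sum_divide_distrib)
    qed
    show "(\<Sum>i<p. M i j) \<le> 1" if "j < ?n" "p \<le> ?n" for j p
    proof -
      have "(\<Sum>i<p. (v i \<bullet> w j)\<^sup>2) \<le> w j \<bullet> w j"
        using that orthonormal_familyD[OF vo] by (intro bessel_subunit) auto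
      moreover have "(\<Sum>i<p. (x i \<bullet> y j)\<^sup>2) \<le> y j \<bullet> y j"
        using that x by (intro bessel_subunit) auto
      ultimately show ?thesis using vv[OF that(1)] y(3)[OF that(1)]
        by (simp add: M_def sum.distrib flip: sum_divide_distrib)
    qed
  qed (auto intro: singular_values_antimono singular_values_nonneg)
  finally show ?thesis .
qed

lemma mirsky_inequality:
  fixes X Y :: "real^'n^'m"
  shows "(\<Sum>i<CARD('n). (singular_values X ! i - singular_values Y ! i)\<^sup>2)
    \<le> (frobenius_norm (X - Y))\<^sup>2"
proof -
  have "(frobenius_norm (X - Y))\<^sup>2 = (frobenius_norm X)\<^sup>2 + (frobenius_norm Y)\<^sup>2 - 2 * (X \<bullet> Y)"
    by (simp add: frobenius_norm_eq_norm power2_norm_eq_inner inner_diff_left inner_diff_right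
        inner_commute)
  moreover have "(\<Sum>i<CARD('n). (singular_values X ! i - singular_values Y ! i)\<^sup>2)
      = (frobenius_norm X)\<^sup>2 + (frobenius_norm Y)\<^sup>2
        - 2 * (\<Sum>i<CARD('n). singular_values X ! i * singular_values Y ! i)"
    by (simp add: power2_diff sum_subtractf sum.distrib frobenius_norm_singular_values
        sum_distrib_left mult.assoc)
  ultimately show ?thesis using von_neumann_trace_inequality[of X Y] by simp
qed

section \<open>Low-rank approximation\<close>

theorem theorem3p4:
  fixes A B :: "real ^ 'n ^ 'm" and k :: nat and \<eta> :: real
  assumes "k \<ge> 1"
    and "CARD('m) \<ge> CARD('n)"
    and "CARD('n) > max k 2"
    and "rank B \<le> k"
    and "\<eta> \<ge> 0"
    and "frobenius_norm (A - B) \<le> sqrt (\<eta>\<^sup>2 + (\<Sum>j = k + 1..CARD('n). (singular_value j A)\<^sup>2))"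
  shows "spectral_norm (A - B) \<le> sqrt (\<eta>\<^sup>2 + (singular_value (k + 1) A)\<^sup>2)
    \<and> sqrt (\<Sum>j = 1..k. (singular_value j A - singular_value j B)\<^sup>2) \<le> \<eta>"
proof
  let ?n = "CARD('n)"
  let ?a = "\<lambda>i. singular_values A ! i" and ?b = "\<lambda>i. singular_values B ! i"
    and ?c = "\<lambda>i. singular_values (A - B) ! i"
  have k: "k < ?n" using assms(3) by simp
  have "(\<Sum>j = k + 1..?n. (singular_value j A)\<^sup>2) = (\<Sum>i\<in>{k..<?n}. (?a i)\<^sup>2)"
    by (rule sum.reindex_bij_witness[of _ Suc "\<lambda>j. j - 1"]) (auto simp: singular_value_def)
  then have "frobenius_norm (A - B) \<le> sqrt (\<eta>\<^sup>2 + (\<Sum>i\<in>{k..<?n}. (?a i)\<^sup>2))"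
    using assms(6) by simp
  then have "(frobenius_norm (A - B))\<^sup>2 \<le> (sqrt (\<eta>\<^sup>2 + (\<Sum>i\<in>{k..<?n}. (?a i)\<^sup>2)))\<^sup>2"
    by (intro power_mono) (simp_all add: frobenius_norm_eq_norm)
  then have F: "(frobenius_norm (A - B))\<^sup>2 \<le> \<eta>\<^sup>2 + (\<Sum>i\<in>{k..<?n}. (?a i)\<^sup>2)"
    by (simp add: sum_nonneg)
  have split: "{k..<?n} = insert k {Suc k..<?n}" using k by auto

  \<comment> \<open>The spectral bound: the tail of \<open>A\<close> after \<open>\<sigma>\<^bsub>k+1\<^esub>\<close> is dominated by the singular values of \<open>A - B\<close>
    other than the largest, so these can be cancelled from the Frobenius estimate.\<close>
  have "(\<Sum>i\<in>{Suc k..<?n}. (?a i)\<^sup>2) \<le> (\<Sum>i\<in>{Suc k..<?n}. (?c (i - k))\<^sup>2)"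
  proof (intro sum_mono power_mono)
    fix i assume "i \<in> {Suc k..<?n}"
    then show "?a i \<le> ?c (i - k)" "0 \<le> ?a i"
      using singular_value_rank_perturbation[OF assms(4), of "i - k" A] singular_values_nonneg[of i A]
      by auto
  qed
  also have "\<dots> = (\<Sum>i\<in>{1..<?n - k}. (?c i)\<^sup>2)"
    by (rule sum.reindex_bij_witness[of _ "\<lambda>i. i + k" "\<lambda>i. i - k"]) auto
  also have "\<dots> \<le> (\<Sum>i\<in>{1..<?n}. (?c i)\<^sup>2)" by (intro sum_mono2) auto
  finally have tail: "(\<Sum>i\<in>{Suc k..<?n}. (?a i)\<^sup>2) \<le> (\<Sum>i\<in>{1..<?n}. (?c i)\<^sup>2)" .
  have "{..<?n} = insert 0 {1..<?n}" using k by auto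
  then have "(?c 0)\<^sup>2 + (\<Sum>i\<in>{1..<?n}. (?c i)\<^sup>2) \<le> \<eta>\<^sup>2 + (?a k)\<^sup>2 + (\<Sum>i\<in>{Suc k..<?n}. (?a i)\<^sup>2)"
    using F unfolding frobenius_norm_singular_values split by simp
  with tail have "(?c 0)\<^sup>2 \<le> \<eta>\<^sup>2 + (?a k)\<^sup>2" by linarith
  then have "?c 0 \<le> sqrt (\<eta>\<^sup>2 + (?a k)\<^sup>2)" by (rule real_le_rsqrt)
  with spectral_norm_le_singular_value[of "A - B"]
  show "spectral_norm (A - B) \<le> sqrt (\<eta>\<^sup>2 + (singular_value (k + 1) A)\<^sup>2)"
    by (simp add: singular_value_def)

  \<comment> \<open>In the Mirsky sum the terms from index \<open>k\<close> on are the tail of \<open>A\<close> itself, which cancels.\<close>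
  have "(\<Sum>i<?n. (?a i - ?b i)\<^sup>2) = (\<Sum>i<k. (?a i - ?b i)\<^sup>2) + (\<Sum>i\<in>{k..<?n}. (?a i - ?b i)\<^sup>2)"
    using k by (subst sum.union_disjoint[symmetric]) (auto intro: sum.cong)
  also have "(\<Sum>i\<in>{k..<?n}. (?a i - ?b i)\<^sup>2) = (\<Sum>i\<in>{k..<?n}. (?a i)\<^sup>2)"
    using singular_values_beyond_rank[OF assms(4)] by (intro sum.cong) auto
  finally have "(\<Sum>i<k. (?a i - ?b i)\<^sup>2) \<le> \<eta>\<^sup>2"
    using mirsky_inequality[of A B] F by linarith
  moreover have "(\<Sum>j = 1..k. (singular_value j A - singular_value j B)\<^sup>2) = (\<Sum>i<k. (?a i - ?b i)\<^sup>2)"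
    by (rule sum.reindex_bij_witness[of _ Suc "\<lambda>j. j - 1"]) (auto simp: singular_value_def)
  ultimately show "sqrt (\<Sum>j = 1..k. (singular_value j A - singular_value j B)\<^sup>2) \<le> \<eta>"
    using assms(5) by (simp add: real_le_lsqrt)
qed

end
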